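(* For every integer $n \geq 3$, the competition number of the ternary Hamming graph satisfies \[ k(H(n,3)) = (n-3)3^{n-1}+6. \]
   Context: For positive integers $n,q$, let $[q]=\{1,\dots,q\}$. The Hamming graph $H(n,q)$ has vertex set $[q]^n$, and two vertices $x,y$ are adjacent iff they differ in exactly one coordinate, i.e. $|\{i\in[n] : x_i\neq y_i\}|=1$. The competition graph $C(D)$ of a digraph $D$ is the simple undirected graph on $V(D)$ in which distinct $u,v$ are adjacent iff there is a vertex $x$ with $(u,x),(v,x)\in A(D)$. For a graph $G$ and integer $k\ge 0$, $G\cup I_k$ denotes $G$ together with a set $I_k$ of $k$ new isolated vertices. The competition number $k(G)$ is the smallest $k\ge 0$ such that $G\cup I_k$ is the competition graph of some acyclic digraph. *)

theory Defs
  imports "Graph_Theory.Pair_Digraph" "HOL-Library.FuncSet"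
begin

text \<open>Simple undirected graphs are represented as in \<^theory>\<open>Graph_Theory.Pair_Digraph\<close>
  (locale \<^locale>\<open>pair_graph\<close>): an edge is a pair of opposite arcs. Tuples over
  \<open>{1..q}\<close> of length \<open>n\<close> are extensional functions on \<open>{1..n}\<close>.\<close>

definition hamming_graph :: "nat \<Rightarrow> nat \<Rightarrow> (nat \<Rightarrow> nat) pair_pre_digraph" where
  "hamming_graph n q =
     \<lparr> pverts = PiE {1..n} (\<lambda>_. {1..q}),
       parcs = {(x, y). x \<in> PiE {1..n} (\<lambda>_. {1..q}) \<and> y \<in> PiE {1..n} (\<lambda>_. {1..q}) \<and>
                        card {i \<in> {1..n}. x i \<noteq> y i} = 1} \<rparr>"

definition competition_graph :: "'a pair_pre_digraph \<Rightarrow> 'a pair_pre_digraph" where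
  "competition_graph D =
     \<lparr> pverts = pverts D,
       parcs = {(u, v). u \<in> pverts D \<and> v \<in> pverts D \<and> u \<noteq> v \<and>
                        (\<exists>x \<in> pverts D. (u, x) \<in> parcs D \<and> (v, x) \<in> parcs D)} \<rparr>"

definition add_isolated :: "'a pair_pre_digraph \<Rightarrow> nat \<Rightarrow> ('a + nat) pair_pre_digraph" where
  "add_isolated G k =
     \<lparr> pverts = Inl ` pverts G \<union> Inr ` {1..k},
       parcs = map_prod Inl Inl ` parcs G \<rparr>"

text \<open>The \<open>LEAST\<close> below is meaningful for every finite simple graph, see
  \<open>competition_number_exists\<close>.\<close>

definition competition_number :: "'a pair_pre_digraph \<Rightarrow> nat" where
  "competition_number G =
     (LEAST k. \<exists>D. pair_digraph D \<and> acyclic (parcs D) \<and> competition_graph D = add_isolated G k)"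

lemma pair_graph_hamming_graph: "pair_graph (hamming_graph n q)"
proof -
  let ?V = "PiE {1..n} (\<lambda>_. {1..q})"
  have fin: "finite ?V" by (intro finite_PiE) auto
  have "finite (parcs (hamming_graph n q))"
    by (rule finite_subset[of _ "?V \<times> ?V"]) (use fin in \<open>auto simp: hamming_graph_def\<close>)
  moreover have "sym (parcs (hamming_graph n q))"
  proof (rule symI)
    fix x y assume xy: "(x, y) \<in> parcs (hamming_graph n q)"
    have "{i \<in> {1..n}. y i \<noteq> x i} = {i \<in> {1..n}. x i \<noteq> y i}" by auto
    then have "card {i \<in> {1..n}. y i \<noteq> x i} = card {i \<in> {1..n}. x i \<noteq> y i}" by simp
    then show "(y, x) \<in> parcs (hamming_graph n q)"
      using xy unfolding hamming_graph_def by simp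
  qed
  ultimately show ?thesis
    using fin by unfold_locales (auto simp: hamming_graph_def symmetric_def)
qed

lemma competition_number_exists:
  assumes "pair_graph G"
  shows "\<exists>k D. pair_digraph D \<and> acyclic (parcs D) \<and> competition_graph D = add_isolated G k"
proof -
  interpret pair_graph G by fact
  obtain f where f: "bij_betw f (parcs G) {1..card (parcs G)}"
    using ex_bij_betw_finite_nat[OF pair_finite_arcs]
      finite_same_card_bij[OF pair_finite_arcs, of "{1..card (parcs G)}"] by auto
  let ?k = "card (parcs G)"
  define A :: "('a + nat) rel" where
    "A = {(Inl u, Inr (f e)) | u e. e \<in> parcs G \<and> (u = fst e \<or> u = snd e)}"
  define D where "D = \<lparr>pverts = Inl ` pverts G \<union> Inr ` {1..?k}, parcs = A\<rparr>"
  have fin: "finite (pverts D)" by (simp add: D_def pair_finite_verts)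
  have fr: "f e \<in> {1..?k}" if "e \<in> parcs G" for e
    using f that by (auto dest: bij_betwE)
  have sub: "A \<subseteq> pverts D \<times> pverts D"
    using fr by (auto simp: D_def A_def dest: in_arcsD1 in_arcsD2)
  have "pair_digraph D"
  proof
    show "finite (parcs D)" using finite_subset[OF sub] fin by (simp add: D_def)
  next
    show "fst e \<in> pverts D" "snd e \<in> pverts D" if "e \<in> parcs D" for e
      using sub that by (auto simp: D_def)
  next
    show "fst e \<noteq> snd e" if "e \<in> parcs D" for e
      using that by (auto simp: D_def A_def)
  qed (fact fin)
  moreover have "acyclic (parcs D)"
  proof -
    have "trans A" by (auto simp: trans_def A_def)
    then show ?thesis by (auto simp: acyclic_def D_def A_def)
  qed
  moreover have "competition_graph D = add_isolated G ?k"
  proof -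
    have sym: "(v, u) \<in> parcs G" if "(u, v) \<in> parcs G" for u v
      using pair_sym_arcs that by (auto simp: symmetric_def sym_def)
    have inj: "e = e'" if "f e = f e'" "e \<in> parcs G" "e' \<in> parcs G" for e e'
      using f that by (auto simp: bij_betw_def inj_on_def)
    have "p \<in> parcs (competition_graph D) \<longleftrightarrow> p \<in> parcs (add_isolated G ?k)" for p
    proof
      assume "p \<in> parcs (competition_graph D)"
      then obtain a b x where p: "p = (a, b)" "a \<noteq> b" "(a, x) \<in> A" "(b, x) \<in> A"
        by (auto simp: competition_graph_def D_def)
      obtain u e where u: "a = Inl u" "x = Inr (f e)" "e \<in> parcs G" "u = fst e \<or> u = snd e"
        using p(3) unfolding A_def by blast
      obtain v e' where v: "b = Inl v" "x = Inr (f e')" "e' \<in> parcs G" "v = fst e' \<or> v = snd e'"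
        using p(4) unfolding A_def by blast
      have "e' = e" using u v by (intro inj) auto
      with u v have e: "a = Inl u" "b = Inl v" "e \<in> parcs G"
        "u = fst e \<or> u = snd e" "v = fst e \<or> v = snd e"
        by auto
      then have "(u, v) \<in> parcs G" using p(2) sym by (cases e) auto
      then show "p \<in> parcs (add_isolated G ?k)"
        using p e by (auto simp: add_isolated_def)
    next
      assume "p \<in> parcs (add_isolated G ?k)"
      then obtain u v where uv: "p = (Inl u, Inl v)" "(u, v) \<in> parcs G"
        by (auto simp: add_isolated_def)
      then have "(Inl u, Inr (f (u, v))) \<in> A" "(Inl v, Inr (f (u, v))) \<in> A"
        by (auto simp: A_def)
      then show "p \<in> parcs (competition_graph D)"
        using uv sub no_loops'[OF uv(2)] by (auto simp: competition_graph_def D_def)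
    qed
    then have "parcs (competition_graph D) = parcs (add_isolated G ?k)" by blast
    then show ?thesis by (simp add: competition_graph_def add_isolated_def D_def)
  qed
  ultimately show ?thesis by blast
qed

end

theory Submission
  imports Defs
begin

text \<open>The cliques of \<open>H(n, 3)\<close> with at least two points lie in unique lines, and in a competition
  digraph the predators of every vertex form a clique. Lower bound: take the first 12 vertices of a
  topological order. They contain at most 7 lines. Any other line has a point outside of them, hence
  an edge at that point whose common prey comes after the first 13 vertices; these prey are distinct
  for distinct lines, so \<open>n 3^(n-1) - 7 \<le> 3^n + k - 13\<close>. Upper bound: there is an order of the points
  in which, for every \<open>m\<close>, at least \<open>m - 5\<close> lines have all their points among the first \<open>m\<close>. Then the line
  completed as number \<open>t\<close> (from 0) can be given the vertex at position \<open>t + 6\<close> as its private common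
  prey, where the new vertices follow the points.\<close>

section \<open>Points, lines and adjacency in the ternary Hamming graph\<close>

declare One_nat_def [simp del]

abbreviation pts :: "nat \<Rightarrow> (nat \<Rightarrow> nat) set" where
  "pts n \<equiv> PiE {1..n} (\<lambda>_. {1..3})"

text \<open>The pair \<open>(p, i)\<close> stands for the line through \<open>p\<close> in direction \<open>i\<close>.\<close>

definition lines :: "nat \<Rightarrow> ((nat \<Rightarrow> nat) \<times> nat) set" where
  "lines n = {(p, i). p \<in> pts n \<and> i \<in> {1..n} \<and> p i = 3}"

lemma finite_pts: "finite (pts n)"
  by (intro finite_PiE) auto

lemma card_pts: "card (pts n) = 3 ^ n"
  by (simp add: card_PiE)

lemma finite_lines: "finite (lines n)"
  by (rule finite_subset[of _ "pts n \<times> {1..n}"]) (auto simp: lines_def finite_pts)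

lemma pts_cases: "p \<in> pts n \<Longrightarrow> i \<in> {1..n} \<Longrightarrow> p i = 1 \<or> p i = 2 \<or> p i = 3"
  by (force simp: PiE_iff)

lemma upd_pts: "p \<in> pts n \<Longrightarrow> i \<in> {1..n} \<Longrightarrow> c \<in> {1..3} \<Longrightarrow> p(i := c) \<in> pts n"
  by (auto simp: PiE_iff extensional_def)

lemma pts_eqI: "p \<in> pts n \<Longrightarrow> q \<in> pts n \<Longrightarrow> (\<And>i. i \<in> {1..n} \<Longrightarrow> p i = q i) \<Longrightarrow> p = q"
  by (rule PiE_ext)

lemma verts_hamming [simp]: "pverts (hamming_graph n 3) = pts n"
  by (simp add: hamming_graph_def)

text \<open>Points are \<open>undefined\<close> outside \<open>{1..n}\<close>, so \<open>j\<close>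
  may range over all numbers; adjacency can then be compared directly with function updates.\<close>

lemma arcs_hamming_iff:
  "(x, y) \<in> parcs (hamming_graph n 3) \<longleftrightarrow>
     x \<in> pts n \<and> y \<in> pts n \<and> (\<exists>i\<in>{1..n}. x i \<noteq> y i \<and> (\<forall>j. j \<noteq> i \<longrightarrow> x j = y j))"
proof -
  have "card {i \<in> {1..n}. x i \<noteq> y i} = 1 \<longleftrightarrow>
      (\<exists>i\<in>{1..n}. x i \<noteq> y i \<and> (\<forall>j. j \<noteq> i \<longrightarrow> x j = y j))"
    if xy: "x \<in> pts n" "y \<in> pts n"
  proof
    assume "card {i \<in> {1..n}. x i \<noteq> y i} = 1"
    then obtain i where i: "{i \<in> {1..n}. x i \<noteq> y i} = {i}" by (rule card_1_singletonE)
    have "x j = y j" if "j \<noteq> i" for j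
    proof (cases "j \<in> {1..n}")
      case True then show ?thesis using i that by blast
    next
      case False then show ?thesis using xy by (metis PiE_arb)
    qed
    then show "\<exists>i\<in>{1..n}. x i \<noteq> y i \<and> (\<forall>j. j \<noteq> i \<longrightarrow> x j = y j)" using i by blast
  next
    assume "\<exists>i\<in>{1..n}. x i \<noteq> y i \<and> (\<forall>j. j \<noteq> i \<longrightarrow> x j = y j)"
    then obtain i where "i \<in> {1..n}" "x i \<noteq> y i" "\<forall>j. j \<noteq> i \<longrightarrow> x j = y j" by blast
    then have "{i \<in> {1..n}. x i \<noteq> y i} = {i}" by auto
    then show "card {i \<in> {1..n}. x i \<noteq> y i} = 1" by simp
  qed
  then show ?thesis by (auto simp: hamming_graph_def)
qed

section \<open>A small set contains few lines\<close>

text \<open>The recursion behind this table: cut the set into three layers along a coordinate that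
  separates two of its points; the lines transversal to the layers are at most as many as the points
  of the smallest layer. Only arguments up to 12 are meaningful.\<close>

definition max_lines :: "nat \<Rightarrow> nat" where
  "max_lines m = [0, 0, 0, 1, 1, 2, 2, 3, 4, 6, 6, 7, 7] ! m"

text \<open>The inequality that carries the induction over layers. It is a finite check; the list
  bounds keep the sum at most 12, inside the table.\<close>

lemma max_lines_add:
  assumes "a < a + b + c" "b < a + b + c" "c < a + b + c" "a + b + c \<le> 12"
  shows "max_lines a + max_lines b + max_lines c + min a (min b c) \<le> max_lines (a + b + c)"
proof -
  have "list_all (\<lambda>a. list_all (\<lambda>b. list_all (\<lambda>c.
      max_lines a + max_lines b + max_lines c + min a (min b c) \<le> max_lines (a + b + c) \<or>
      a + b + c = a \<or> a + b + c = b \<or> a + b + c = c)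
      [0..<13 - a - b]) [0..<13 - a]) [0..<13]"
    by code_simp
  then show ?thesis using assms unfolding list_all_iff by force
qed

definition lines_in :: "nat \<Rightarrow> (nat \<Rightarrow> nat) set \<Rightarrow> ((nat \<Rightarrow> nat) \<times> nat) set" where
  "lines_in n S = {(p, i) \<in> lines n. \<forall>c\<in>{1..3}. p(i := c) \<in> S}"

lemma finite_lines_in: "finite (lines_in n S)"
  by (rule finite_subset[OF _ finite_lines]) (auto simp: lines_in_def)

text \<open>Parallel lines are disjoint, so each of them uses a point of its own in every layer
  across direction \<open>j\<close>.\<close>

lemma card_lines_in_direction:
  assumes "finite S" "c \<in> {1..3}"
  shows "card {(p, i) \<in> lines_in n S. i = j} \<le> card {p \<in> S. p j = c}"
proof (rule card_inj_on_le[where f = "\<lambda>(p, i). p(j := c)"])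
  show "inj_on (\<lambda>(p, i). p(j := c)) {(p, i) \<in> lines_in n S. i = j}"
  proof (rule inj_onI, clarsimp)
    fix p q assume "(p, j) \<in> lines_in n S" "(q, j) \<in> lines_in n S" "p(j := c) = q(j := c)"
    \<comment> \<open>Both representatives have entry 3 at \<open>j\<close>, so the update can be
      undone.\<close>
    then show "p = q"
      by (intro ext) (metis (mono_tags, lifting) fun_upd_apply lines_def lines_in_def mem_Collect_eq case_prodD)
  qed
  show "(\<lambda>(p, i). p(j := c)) ` {(p, i) \<in> lines_in n S. i = j} \<subseteq> {p \<in> S. p j = c}"
    using assms by (auto simp: lines_in_def)
qed (use assms in auto)

lemma card_lines_in:
  assumes "S \<subseteq> pts n" "card S \<le> 12"
  shows "card (lines_in n S) \<le> max_lines (card S)"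
  using assms
proof (induction "card S" arbitrary: S rule: less_induct)
  case less
  have fin: "finite S" using less.prems finite_pts finite_subset by blast
  show ?case
  proof (cases "\<exists>j\<in>{1..n}. \<exists>x\<in>S. \<exists>y\<in>S. x j \<noteq> y j")
    case False
    have "\<not> (\<forall>c\<in>{1..3}. p(i := c) \<in> S)" if "i \<in> {1..n}" for p and i
    proof
      assume "\<forall>c\<in>{1..3}. p(i := c) \<in> S"
      then have "p(i := 1) \<in> S" "p(i := 2) \<in> S" by auto
      then have "(p(i := 1)) i = (p(i := 2)) i" using False that by blast
      then show False by simp
    qed
    then have "lines_in n S = {}" by (auto simp: lines_in_def lines_def)
    then show ?thesis by simp
  next
    case True
    then obtain j x y where j: "j \<in> {1..n}" "x \<in> S" "y \<in> S" "x j \<noteq> y j" by blast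
    define L where "L c = {p \<in> S. p j = c}" for c
    have S: "S = L 1 \<union> (L 2 \<union> L 3)"
      using less.prems(1) pts_cases[OF _ j(1)] unfolding L_def by blast
    have finL: "finite (L c)" for c using fin by (simp add: L_def)
    have cS: "card S = card (L 1) + card (L 2) + card (L 3)"
      unfolding S using finL by (subst card_Un_disjoint; (subst card_Un_disjoint)?) (auto simp: L_def)
    \<comment> \<open>Since \<open>j\<close> separates \<open>x\<close> and \<open>y\<close>, every
      layer misses one of them, and the induction hypothesis applies.\<close>
    have lt: "card (L c) < card S" for c
    proof (rule psubset_card_mono[OF fin])
      have "L c \<subseteq> S" "x \<notin> L c \<or> y \<notin> L c" using j(4) by (auto simp: L_def)
      then show "L c \<subset> S" using j(2,3) by blast
    qed
    have IH: "card (lines_in n (L c)) \<le> max_lines (card (L c))" for c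
      using less.hyps[OF lt, of c] less.prems lt[of c] by (auto simp: L_def)
    define J where "J = {(p, i) \<in> lines_in n S. i = j}"
    have J: "card J \<le> card (L c)" if "c \<in> {1..3}" for c
      unfolding J_def L_def by (rule card_lines_in_direction[OF fin that])
    \<comment> \<open>A line in a direction other than \<open>j\<close> has a constant entry at
      \<open>j\<close>, hence stays in one layer.\<close>
    have "lines_in n S \<subseteq> (lines_in n (L 1) \<union> lines_in n (L 2) \<union> lines_in n (L 3)) \<union> J"
    proof clarify
      fix p i assume a: "(p, i) \<in> lines_in n S" "(p, i) \<notin> J"
        "(p, i) \<notin> lines_in n (L 3)" "(p, i) \<notin> lines_in n (L 2)"
      then have "i \<noteq> j" "p \<in> pts n" by (auto simp: J_def lines_in_def lines_def)
      with a pts_cases[OF _ j(1), of p] show "(p, i) \<in> lines_in n (L 1)"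
        by (auto simp: lines_in_def L_def)
    qed
    then have "card (lines_in n S) \<le>
        card ((lines_in n (L 1) \<union> lines_in n (L 2) \<union> lines_in n (L 3)) \<union> J)"
      by (intro card_mono) (auto simp: finite_lines_in J_def intro: finite_subset[OF _ finite_lines_in])
    also have "\<dots> \<le> card (lines_in n (L 1)) + card (lines_in n (L 2)) + card (lines_in n (L 3)) + card J"
      by (meson card_Un_le add_le_mono order_refl order_trans)
    also have "\<dots> \<le> max_lines (card (L 1)) + max_lines (card (L 2)) + max_lines (card (L 3))
        + min (card (L 1)) (min (card (L 2)) (card (L 3)))"
      using J by (intro add_mono IH) auto
    also have "\<dots> \<le> max_lines (card S)"
      unfolding cS using lt less.prems(2) unfolding cS by (intro max_lines_add)
    finally show ?thesis .
  qed
qed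

lemma card_lines_in_le_7:
  assumes "S \<subseteq> pts n" "card S \<le> 12"
  shows "card (lines_in n S) \<le> 7"
proof -
  have "list_all (\<lambda>m. max_lines m \<le> 7) [0..<13]" by code_simp
  moreover have "card S \<in> set [0..<13]" using assms(2) unfolding set_upt by simp
  ultimately have "max_lines (card S) \<le> 7" unfolding list_all_iff by blast
  then show ?thesis using card_lines_in[OF assms] by (rule le_trans[rotated])
qed

section \<open>The order of completion\<close>

text \<open>The layer \<open>p (n + 1) = 1\<close> comes first, in the order of dimension \<open>n\<close>; then the points of the other
  two layers come in pairs, again in the order of dimension \<open>n\<close>. Every line is completed by its point
  with entry 3, so a point completes as many lines as it has entries 3.\<close>

primrec pos :: "nat \<Rightarrow> (nat \<Rightarrow> nat) \<Rightarrow> nat" where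
  "pos 0 p = 0"
| "pos (Suc n) p = (if p (Suc n) = 1 then pos n p else 3 ^ n + 2 * pos n p + (p (Suc n) - 2))"

definition threes :: "nat \<Rightarrow> (nat \<Rightarrow> nat) \<Rightarrow> nat" where
  "threes n p = card {i \<in> {1..n}. p i = 3}"

text \<open>The number of entries 3 of the point at position \<open>m\<close>, see \<open>threes_at_pos\<close>.\<close>

primrec threes_at :: "nat \<Rightarrow> nat \<Rightarrow> nat" where
  "threes_at 0 m = 0"
| "threes_at (Suc n) m =
     (if m < 3 ^ n then threes_at n m else threes_at n ((m - 3 ^ n) div 2) + (m - 3 ^ n) mod 2)"

text \<open>Unlike \<open>pts\<close>, this does not ask for extensionality, so in inductions on
  \<open>n\<close> the same function serves as its own projection.\<close>

definition ternary :: "nat \<Rightarrow> (nat \<Rightarrow> nat) \<Rightarrow> bool" where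
  "ternary n p \<longleftrightarrow> (\<forall>i\<in>{1..n}. p i = 1 \<or> p i = 2 \<or> p i = 3)"

lemma ternary_pts: "p \<in> pts n \<Longrightarrow> ternary n p"
  unfolding ternary_def using pts_cases by blast

lemma ternary_Suc:
  "ternary (Suc n) p \<longleftrightarrow> ternary n p \<and> (p (Suc n) = 1 \<or> p (Suc n) = 2 \<or> p (Suc n) = 3)"
  by (auto simp: ternary_def le_Suc_eq)

lemma pos_less: "ternary n p \<Longrightarrow> pos n p < 3 ^ n"
  by (induction n) (auto simp: ternary_Suc)

lemma pos_cong: "(\<And>i. i \<in> {1..n} \<Longrightarrow> p i = q i) \<Longrightarrow> pos n p = pos n q"
  by (induction n) auto

text \<open>Positions below \<open>3 ^ n\<close> belong to the first layer; beyond them, parity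
  gives the last entry and halving gives the position of the projection.\<close>

lemma pos_inj:
  "ternary n p \<Longrightarrow> ternary n q \<Longrightarrow> pos n p = pos n q \<Longrightarrow> \<forall>i\<in>{1..n}. p i = q i"
proof (induction n)
  case (Suc n)
  note less = pos_less[of n p] pos_less[of n q]
  have "pos n p = pos n q \<and> p (Suc n) = q (Suc n)"
    using Suc.prems less unfolding ternary_Suc by (elim conjE disjE) (simp_all; presburger)+
  then show ?case using Suc by (auto simp: ternary_Suc le_Suc_eq)
qed simp

lemma bij_betw_pos: "bij_betw (pos n) (pts n) {..<3 ^ n}"
proof -
  have "inj_on (pos n) (pts n)"
    using pos_inj ternary_pts by (intro inj_onI pts_eqI) blast+
  moreover have "pos n ` pts n \<subseteq> {..<3 ^ n}" using pos_less ternary_pts by blast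
  moreover have "card (pos n ` pts n) = 3 ^ n" using calculation(1) by (simp add: card_image card_pts)
  ultimately show ?thesis unfolding bij_betw_def by (metis card_lessThan card_subset_eq finite_lessThan)
qed

text \<open>The point with entry 3 is the last one of its line. In direction \<open>Suc n\<close>
  this is read off the recursion; otherwise \<open>pos (Suc n)\<close> is monotone in
  \<open>pos n\<close> for a fixed last entry.\<close>

lemma pos_upd_le:
  "ternary n p \<Longrightarrow> i \<in> {1..n} \<Longrightarrow> p i = 3 \<Longrightarrow> c \<in> {1..3} \<Longrightarrow> pos n (p(i := c)) \<le> pos n p"
proof (induction n)
  case (Suc n)
  have c: "c = 1 \<or> c = 2 \<or> c = 3" using Suc.prems by auto
  show ?case
  proof (cases "i = Suc n")
    case True
    have "pos n (p(i := c)) = pos n p" by (rule pos_cong) (auto simp: True)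
    moreover have "(p(i := c)) (Suc n) = c" by (simp add: True)
    ultimately show ?thesis using True c Suc.prems by (auto simp del: fun_upd_apply)
  next
    case False
    then have "pos n (p(i := c)) \<le> pos n p"
      using Suc by (auto simp: ternary_Suc simp del: fun_upd_apply)
    moreover have "(p(i := c)) (Suc n) = p (Suc n)" using False by simp
    ultimately show ?thesis by (simp del: fun_upd_apply)
  qed
qed simp

lemma threes_Suc: "threes (Suc n) p = threes n p + (if p (Suc n) = 3 then 1 else 0)"
proof -
  have "{i \<in> {1..Suc n}. p i = 3} =
      {i \<in> {1..n}. p i = 3} \<union> (if p (Suc n) = 3 then {Suc n} else {})"
    by (auto simp: le_Suc_eq)
  then show ?thesis by (simp add: threes_def)
qed

lemma threes_at_pos: "ternary n p \<Longrightarrow> threes_at n (pos n p) = threes n p"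
proof (induction n)
  case (Suc n)
  then show ?case using pos_less[of n p] by (auto simp: ternary_Suc threes_Suc)
qed (simp add: threes_def)

text \<open>For \<open>m \<le> 3 ^ n\<close> this counts the lines that lie wholly among the first
  \<open>m\<close> points, through their last points; see
  \<open>card_lines_pos_less\<close>.\<close>

definition completed :: "nat \<Rightarrow> nat \<Rightarrow> nat" where
  "completed n m = (\<Sum>j<m. threes_at n j)"

lemma completed_Suc: "completed n (Suc m) = completed n m + threes_at n m"
  by (simp add: completed_def)

lemma completed_Suc_low: "m \<le> 3 ^ n \<Longrightarrow> completed (Suc n) m = completed n m"
  unfolding completed_def by (intro sum.cong) auto

text \<open>The pair over the point at position \<open>j\<close> contributes
  \<open>threes_at n j\<close> twice, plus 1 for the entry 3 in the new coordinate.\<close>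

lemma completed_Suc_even:
  "completed (Suc n) (3 ^ n + 2 * r) = completed n (3 ^ n) + 2 * completed n r + r"
proof (induction r)
  case 0
  then show ?case by (simp add: completed_Suc_low) (simp add: completed_def)
next
  case (Suc r)
  have "3 ^ n + 2 * Suc r = Suc (Suc (3 ^ n + 2 * r))" by simp
  moreover have "Suc (3 ^ n + 2 * r) - 3 ^ n = Suc (2 * r)" by simp
  ultimately show ?case using Suc by (simp only: completed_Suc) simp
qed

lemma completed_Suc_odd:
  "completed (Suc n) (3 ^ n + 2 * r + 1) =
     completed n (3 ^ n) + completed n r + completed n (Suc r) + r"
  using completed_Suc_even[of n r] unfolding Suc_eq_plus1[symmetric] completed_Suc by simp

text \<open>The total is n 3^(n-1); the factor 3 avoids the exponent \<open>n - 1\<close>.\<close>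

lemma completed_all: "3 * completed n (3 ^ n) = n * 3 ^ n"
proof (induction n)
  case 0
  then show ?case by (simp add: completed_def)
next
  case (Suc n)
  have "3 ^ Suc n = 3 ^ n + 2 * (3 :: nat) ^ n" by simp
  then show ?case using Suc by (simp only: completed_Suc_even) simp
qed

text \<open>In the induction step the full first layer leaves no deficit, and each pair of points after it
  completes one line more than twice its projection, which absorbs the doubling of the deficit 5.\<close>

lemma completed_ge: "3 \<le> n \<Longrightarrow> m \<le> 3 ^ n \<Longrightarrow> m \<le> completed n m + 5"
proof (induction n arbitrary: m rule: nat_induct_at_least)
  case base
  have "list_all (\<lambda>m. m \<le> sum_list (map (threes_at 3) [0..<m]) + 5) [0..<28]" by code_simp
  moreover have "completed 3 m = sum_list (map (threes_at 3) [0..<m])"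
    by (simp add: completed_def interv_sum_list_conv_sum_set_nat atLeast0LessThan)
  ultimately show ?case using base by (simp add: list_all_iff)
next
  case (Suc n)
  show ?case
  proof (cases "m \<le> 3 ^ n")
    case True
    then show ?thesis using Suc by (simp add: completed_Suc_low)
  next
    case False
    define r where "r = (m - 3 ^ n) div 2"
    have m: "m = 3 ^ n + 2 * r \<or> m = 3 ^ n + 2 * r + 1" unfolding r_def using False by presburger
    have "3 * 3 ^ n \<le> n * 3 ^ n" using Suc.hyps by simp
    then have full: "3 ^ n \<le> completed n (3 ^ n)" using completed_all[of n] by linarith
    from m show ?thesis
    proof
      assume m: "m = 3 ^ n + 2 * r"
      then have "r \<le> completed n r + 5" using Suc by auto
      then show ?thesis using full unfolding m completed_Suc_even by linarith
    next
      assume m: "m = 3 ^ n + 2 * r + 1"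
      then have "r \<le> completed n r + 5" "Suc r \<le> completed n (Suc r) + 5" using Suc by auto
      then show ?thesis using full unfolding m completed_Suc_odd by linarith
    qed
  qed
qed

lemma card_lines_pos_less:
  assumes "m \<le> 3 ^ n"
  shows "card {(p, i) \<in> lines n. pos n p < m} = completed n m"
proof -
  let ?A = "{p \<in> pts n. pos n p < m}"
  have "{(p, i) \<in> lines n. pos n p < m} = Sigma ?A (\<lambda>p. {i \<in> {1..n}. p i = 3})"
    by (auto simp: lines_def)
  then have "card {(p, i) \<in> lines n. pos n p < m} = (\<Sum>p\<in>?A. threes n p)"
    unfolding threes_def by (simp add: finite_pts)
  also have "\<dots> = (\<Sum>p\<in>?A. threes_at n (pos n p))"
    by (intro sum.cong) (auto simp: threes_at_pos ternary_pts)
  finally have sum: "card {(p, i) \<in> lines n. pos n p < m} = (\<Sum>p\<in>?A. threes_at n (pos n p))" .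
  have "bij_betw (pos n) ?A {..<m}"
  proof -
    have "pos n ` ?A = {..<m}"
    proof
      show "{..<m} \<subseteq> pos n ` ?A"
      proof
        fix j assume "j \<in> {..<m}"
        then have "j \<in> pos n ` pts n" "j < m" using assms bij_betw_pos[of n] by (auto simp: bij_betw_def)
        then show "j \<in> pos n ` ?A" by auto
      qed
    qed auto
    then show ?thesis
      using bij_betw_pos[of n] unfolding bij_betw_def by (auto intro: inj_on_subset)
  qed
  then have "(\<Sum>p\<in>?A. threes_at n (pos n p)) = completed n m"
    unfolding completed_def by (rule sum.reindex_bij_betw)
  with sum show ?thesis by simp
qed

lemma card_lines: "3 * card (lines n) = n * 3 ^ n"
proof -
  have "{(p, i) \<in> lines n. pos n p < 3 ^ n} = lines n"
    using pos_less ternary_pts by (auto simp: lines_def)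
  then show ?thesis using card_lines_pos_less[of "3 ^ n" n] completed_all[of n] by simp
qed

section \<open>The lower bound\<close>

text \<open>\<open>S\<close> is an initial segment of a topological order, grown by minimal
  elements, and \<open>x\<close> is the next vertex. The in-neighbours of \<open>x\<close> also lie
  in \<open>S\<close>, so a segment of size \<open>m\<close> controls \<open>m + 1\<close> possible
  prey.\<close>

lemma acyclic_prefix:
  assumes "finite V" "R \<subseteq> V \<times> V" "acyclic R" "m < card V"
  obtains S x where "S \<subseteq> V" "card S = m" "x \<in> V - S"
    "\<And>y z. (y, z) \<in> R \<Longrightarrow> z \<in> insert x S \<Longrightarrow> y \<in> S"
proof -
  have wf: "wf R"
    using assms by (intro finite_acyclic_wf) (auto intro: finite_subset)
  have step: "\<exists>x\<in>V - S. \<forall>y. (y, x) \<in> R \<longrightarrow> y \<in> S" if "S \<subseteq> V" "card S < card V" for S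
  proof -
    have "V - S \<noteq> {}" using that by auto
    then obtain x where "x \<in> V - S" "\<And>y. (y, x) \<in> R \<Longrightarrow> y \<notin> V - S"
      using wfE_min[OF wf] by (metis ex_in_conv)
    then show ?thesis using assms(2) by blast
  qed
  have "\<exists>S. S \<subseteq> V \<and> card S = l \<and> (\<forall>y z. (y, z) \<in> R \<longrightarrow> z \<in> S \<longrightarrow> y \<in> S)" if "l \<le> m" for l
    using that
  proof (induction l)
    case 0
    show ?case by (rule exI[of _ "{}"]) simp
  next
    case (Suc l)
    then obtain S where S: "S \<subseteq> V" "card S = l" "\<forall>y z. (y, z) \<in> R \<longrightarrow> z \<in> S \<longrightarrow> y \<in> S" by auto
    then obtain x where "x \<in> V - S" "\<forall>y. (y, x) \<in> R \<longrightarrow> y \<in> S"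
      using step[of S] assms(4) Suc.prems by auto
    then show ?case
      using S assms(1) by (intro exI[of _ "insert x S"]) (auto simp: finite_subset)
  qed
  then obtain S where S: "S \<subseteq> V" "card S = m" "\<forall>y z. (y, z) \<in> R \<longrightarrow> z \<in> S \<longrightarrow> y \<in> S" by blast
  moreover obtain x where "x \<in> V - S" "\<forall>y. (y, x) \<in> R \<longrightarrow> y \<in> S"
    using step[of S] assms(4) S by auto
  ultimately show thesis using that[of S x] by blast
qed

text \<open>Two pairs of distinct points on lines, any two of the four points differing in at most
  one coordinate, span the same line. The entry 3 makes the representative of a line unique.\<close>

lemma line_unique:
  assumes diff: "\<And>u v. u \<in> {p(i := a), p(i := b)} \<Longrightarrow> v \<in> {q(j := c), q(j := d)} \<Longrightarrow>
      \<exists>l. \<forall>h. h \<noteq> l \<longrightarrow> u h = v h"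
    and ne: "a \<noteq> b" "c \<noteq> d" and top: "p i = 3" "q j = (3 :: nat)"
  shows "(p, i) = (q, j)"
proof -
  have agree: "v h = p h" if v: "v \<in> {q(j := c), q(j := d)}" and h: "h \<noteq> i" for v h
  proof -
    \<comment> \<open>This choice makes \<open>p(i := e)\<close> and \<open>v\<close> differ at
      \<open>i\<close> already, so they agree everywhere else.\<close>
    from ne obtain e where e: "e \<in> {a, b}" "e \<noteq> v i" by auto
    then obtain l where "\<forall>h. h \<noteq> l \<longrightarrow> (p(i := e)) h = v h" using diff[OF _ v, of "p(i := e)"] by blast
    with e h show ?thesis by (metis fun_upd_apply)
  qed
  have "i = j"
    using agree[of "q(j := c)" j] agree[of "q(j := d)" j] ne by auto
  moreover have "p h = q h" for h
    using agree[of "q(j := c)" h] top \<open>i = j\<close> by (cases "h = i") auto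
  ultimately show ?thesis by auto
qed

lemma competition_lower_bound:
  assumes D: "pair_digraph D" "acyclic (parcs D)"
    and C: "competition_graph D = add_isolated (hamming_graph n 3) k"
    and n: "3 \<le> n"
  shows "card (lines n) + 6 \<le> 3 ^ n + k"
proof -
  interpret pair_digraph D by fact
  have V: "pverts D = Inl ` pts n \<union> Inr ` {1..k}"
    using arg_cong[OF C, of pverts] by (simp add: competition_graph_def add_isolated_def)
  have cardV: "card (pverts D) = 3 ^ n + k"
    unfolding V by (subst card_Un_disjoint) (auto simp: finite_pts card_image card_pts)
  have prey: "(u, v) \<in> parcs (hamming_graph n 3) \<longleftrightarrow> u \<in> pts n \<and> v \<in> pts n \<and> u \<noteq> v \<and>
      (\<exists>x\<in>pverts D. (Inl u, x) \<in> parcs D \<and> (Inl v, x) \<in> parcs D)" for u v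
  proof -
    have "(Inl u, Inl v) \<in> parcs (add_isolated (hamming_graph n 3) k) \<longleftrightarrow>
        (u, v) \<in> parcs (hamming_graph n 3)"
      by (auto simp: add_isolated_def)
    then show ?thesis unfolding C[symmetric] by (auto simp: competition_graph_def V)
  qed
  have "3 ^ 3 \<le> (3 :: nat) ^ n" using n by (intro power_increasing) auto
  then have "12 < card (pverts D)" unfolding cardV by simp
  moreover have "parcs D \<subseteq> pverts D \<times> pverts D"
    using in_arcsD1 in_arcsD2 by auto
  ultimately obtain S x where S: "S \<subseteq> pverts D" "card S = 12" "x \<in> pverts D - S"
    "\<And>y z. (y, z) \<in> parcs D \<Longrightarrow> z \<in> insert x S \<Longrightarrow> y \<in> S"
    using acyclic_prefix[OF pair_finite_verts _ D(2), of 12] by blast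
  have finS: "finite S" using S(1) pair_finite_verts finite_subset by blast
  define P where "P = {p. Inl p \<in> S}"
  have "P \<subseteq> pts n" using S(1) V by (auto simp: P_def)
  moreover have "card P \<le> 12"
    using card_inj_on_le[of Inl P S] finS S(2) by (auto simp: P_def)
  ultimately have seven: "card (lines_in n P) \<le> 7" by (rule card_lines_in_le_7)
  define W where "W = pverts D - insert x S"
  have "card (insert x S) = 13" using S finS by simp
  then have cardW: "card W + 13 = 3 ^ n + k"
    using card_Diff_subset[of "insert x S" "pverts D"] card_mono[of "pverts D" "insert x S"] S finS
    unfolding W_def cardV[symmetric] by (auto simp: pair_finite_verts)
  have "\<exists>w\<in>W. \<exists>a\<in>{1..3}. \<exists>b\<in>{1..3}. a \<noteq> b \<and>
      (Inl ((fst l)(snd l := a)), w) \<in> parcs D \<and> (Inl ((fst l)(snd l := b)), w) \<in> parcs D"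
    if l: "l \<in> lines n - lines_in n P" for l
  proof -
    obtain p i where pi: "l = (p, i)" "p \<in> pts n" "i \<in> {1..n}" using l by (auto simp: lines_def)
    \<comment> \<open>The point outside \<open>P\<close> cannot have prey in
      \<open>insert x S\<close>, whose in-neighbours are all in \<open>S\<close>; this forces the
      common prey into \<open>W\<close>.\<close>
    from l obtain a where a: "a \<in> {1..3}" "p(i := a) \<notin> P" by (auto simp: lines_in_def pi(1))
    obtain b :: nat where b: "b \<in> {1..3}" "b \<noteq> a"
    proof (cases "a = 1")
      case True then show thesis using that[of 2] by simp
    next
      case False then show thesis using that[of 1] by simp
    qed
    have "(p(i := a), p(i := b)) \<in> parcs (hamming_graph n 3)"
      unfolding arcs_hamming_iff using pi a b by (auto simp: upd_pts intro!: bexI[of _ i])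
    then obtain w where w: "w \<in> pverts D" "(Inl (p(i := a)), w) \<in> parcs D" "(Inl (p(i := b)), w) \<in> parcs D"
      unfolding prey by blast
    then have "w \<in> W" using S(4)[OF w(2)] a(2) by (auto simp: W_def P_def)
    then show ?thesis
      using w(2,3) a(1) b(1) b(2)[symmetric] unfolding pi(1) fst_conv snd_conv by blast
  qed
  then obtain f where f: "\<And>l. l \<in> lines n - lines_in n P \<Longrightarrow> f l \<in> W \<and> (\<exists>a\<in>{1..3}. \<exists>b\<in>{1..3}. a \<noteq> b \<and>
      (Inl ((fst l)(snd l := a)), f l) \<in> parcs D \<and> (Inl ((fst l)(snd l := b)), f l) \<in> parcs D)"
    by metis
  have "inj_on f (lines n - lines_in n P)"
  proof (rule inj_onI)
    fix l l' assume l: "l \<in> lines n - lines_in n P" and l': "l' \<in> lines n - lines_in n P"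
      and eq: "f l = f l'"
    obtain p i where pi: "l = (p, i)" "p \<in> pts n" "i \<in> {1..n}" "p i = 3"
      using l by (auto simp: lines_def)
    obtain q j where qj: "l' = (q, j)" "q \<in> pts n" "j \<in> {1..n}" "q j = 3"
      using l' by (auto simp: lines_def)
    obtain a b where ab: "a \<in> {1..3}" "b \<in> {1..3}" "a \<noteq> b"
      "(Inl (p(i := a)), f l) \<in> parcs D" "(Inl (p(i := b)), f l) \<in> parcs D"
      using f[OF l] pi(1) by auto
    obtain c d where cd: "c \<in> {1..3}" "d \<in> {1..3}" "c \<noteq> d"
      "(Inl (q(j := c)), f l) \<in> parcs D" "(Inl (q(j := d)), f l) \<in> parcs D"
      using f[OF l'] qj(1) eq by auto
    have "\<exists>h. \<forall>g. g \<noteq> h \<longrightarrow> u g = v g"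
      if u: "u \<in> {p(i := a), p(i := b)}" and v: "v \<in> {q(j := c), q(j := d)}" for u v
    \<comment> \<open>Lines with the same chosen prey put all four points among its predators, so
      any two of them are equal or adjacent.\<close>
    proof (cases "u = v")
      case False
      have "(Inl u, f l) \<in> parcs D" "(Inl v, f l) \<in> parcs D" using u v ab cd by auto
      moreover have "u \<in> pts n" "v \<in> pts n"
        using u v ab cd upd_pts[OF pi(2,3)] upd_pts[OF qj(2,3)] by auto
      moreover have "f l \<in> pverts D" using f[OF l] by (auto simp: W_def)
      ultimately have "(u, v) \<in> parcs (hamming_graph n 3)" unfolding prey using False by blast
      then show ?thesis unfolding arcs_hamming_iff by blast
    qed simp
    then have "(p, i) = (q, j)" using ab(3) cd(3) pi(4) qj(4) by (rule line_unique)
    then show "l = l'" using pi(1) qj(1) by simp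
  qed
  moreover have "f ` (lines n - lines_in n P) \<subseteq> W" using f by auto
  moreover have "finite W" by (simp add: W_def pair_finite_verts)
  ultimately have "card (lines n - lines_in n P) \<le> card W" by (rule card_inj_on_le)
  moreover have "card (lines n) \<le> card (lines n - lines_in n P) + card (lines_in n P)"
    using diff_card_le_card_Diff[OF finite_lines_in, of "lines n" n P] by linarith
  ultimately show ?thesis using seven cardW by linarith
qed

section \<open>The upper bound\<close>

text \<open>Sorting by \<open>w\<close> with ties broken arbitrarily: an element of maximal weight
  is appended last, which leaves the counts of the others unchanged.\<close>

lemma exists_ranking:
  fixes w :: "'a \<Rightarrow> 'b :: linorder"
  assumes "finite A"
  shows "\<exists>r. bij_betw r A {..<card A} \<and> (\<forall>a\<in>A. card {b \<in> A. w b < w a} \<le> r a)"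
  using assms
proof (induction A rule: finite_ranking_induct[where f = w])
  case empty
  then show ?case by (simp add: bij_betw_def)
next
  case (insert x S)
  show ?case
  proof (cases "x \<in> S")
    case True then show ?thesis using insert by (simp add: insert_absorb)
  next
    case False
    from insert obtain r where r: "bij_betw r S {..<card S}"
      "\<And>a. a \<in> S \<Longrightarrow> card {b \<in> S. w b < w a} \<le> r a" by blast
    let ?r = "r(x := card S)"
    have "bij_betw ?r S {..<card S}" using r(1) False by (subst bij_betw_cong[of _ _ r]) auto
    then have "bij_betw ?r (S \<union> {x}) ({..<card S} \<union> {card S})"
      by (rule bij_betw_combine) (auto simp: bij_betw_def)
    moreover have "{..<card S} \<union> {card S} = {..<card (insert x S)}"
      using insert False by auto
    moreover have "card {b \<in> insert x S. w b < w a} \<le> ?r a" if a: "a \<in> insert x S" for a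
    proof (cases "a = x")
      case True
      have "card {b \<in> insert x S. w b < w x} \<le> card S"
        using insert(1) by (intro card_mono) auto
      then show ?thesis using True by simp
    next
      case ax: False
      then have "{b \<in> insert x S. w b < w a} = {b \<in> S. w b < w a}"
        using insert(2)[of a] a by auto
      then show ?thesis using r(2)[of a] ax a by simp
    qed
    ultimately show ?thesis by (intro exI[of _ ?r]) (simp del: fun_upd_apply)
  qed
qed

lemma competition_upper_bound:
  assumes n: "3 \<le> n" and k: "3 ^ n + k = card (lines n) + 6"
  shows "\<exists>D. pair_digraph D \<and> acyclic (parcs D) \<and>
    competition_graph D = add_isolated (hamming_graph n 3) k"
proof -
  obtain r where r: "bij_betw r (lines n) {..<card (lines n)}"
    and rank: "\<And>l. l \<in> lines n \<Longrightarrow> card {b \<in> lines n. pos n (fst b) < pos n (fst l)} \<le> r l"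
    using exists_ranking[OF finite_lines, of n "\<lambda>l. pos n (fst l)"] by blast
  \<comment> \<open>At least \<open>completed n (pos n p)\<close> lines are completed strictly
    earlier, so the deficit bound 5 passes to the rank; position \<open>r l + 6\<close> is then
    strictly later than the whole line.\<close>
  have r_ge: "pos n p \<le> r (p, i) + 5" if "(p, i) \<in> lines n" for p i
  proof -
    have "pos n p \<le> 3 ^ n"
      using that pos_less ternary_pts by (auto simp: lines_def intro: less_imp_le)
    moreover have "{b \<in> lines n. pos n (fst b) < pos n p} = {(q, j) \<in> lines n. pos n q < pos n p}"
      by auto
    ultimately show ?thesis
      using rank[OF that] completed_ge[OF n, of "pos n p"] by (simp add: card_lines_pos_less)
  qed
  define V :: "((nat \<Rightarrow> nat) + nat) set" where "V = Inl ` pts n \<union> Inr ` {1..k}"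
  \<comment> \<open>Positions start at 0 but new vertices at 1, hence the shift.\<close>
  define place where "place = case_sum (pos n) (\<lambda>j. 3 ^ n + j - 1)"
  have finV: "finite V" by (simp add: V_def finite_pts)
  have "bij_betw place V ({..<3 ^ n} \<union> {3 ^ n..<3 ^ n + k})"
    unfolding V_def
  proof (rule bij_betw_combine)
    show "bij_betw place (Inl ` pts n) {..<3 ^ n}"
      using bij_betw_pos[of n] by (auto simp: bij_betw_def inj_on_def place_def image_image)
    show "bij_betw place (Inr ` {1..k}) {3 ^ n..<3 ^ n + k}"
      by (rule bij_betw_byWitness[where f' = "\<lambda>j. Inr (j + 1 - 3 ^ n)"])
        (auto simp: place_def intro!: imageI)
  qed auto
  moreover have "{..<3 ^ n} \<union> {3 ^ n..<3 ^ n + k} = {..<3 ^ n + k}" by auto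
  ultimately have place: "bij_betw place V {..<card (lines n) + 6}" using k by simp
  define prey where "prey l = inv_into V place (r l + 6)" for l
  have prey: "prey l \<in> V \<and> place (prey l) = r l + 6" if "l \<in> lines n" for l
  proof -
    have "r l < card (lines n)" using r that by (auto simp: bij_betw_def)
    then have "r l + 6 \<in> place ` V" using place by (auto simp: bij_betw_def)
    then show ?thesis unfolding prey_def by (auto intro: inv_into_into f_inv_into_f)
  qed
  have prey_inj: "l = l'" if "l \<in> lines n" "l' \<in> lines n" "prey l = prey l'" for l l'
  proof -
    have "r l = r l'" using prey[OF that(1)] prey[OF that(2)] that(3) by simp
    then show ?thesis using r that by (auto simp: bij_betw_def inj_on_def)
  qed
  define A :: "((nat \<Rightarrow> nat) + nat) rel" where
    "A = {(Inl (p(i := c)), prey (p, i)) | p i c. (p, i) \<in> lines n \<and> c \<in> {1..3}}"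
  define D where "D = \<lparr>pverts = V, parcs = A\<rparr>"
  have sub: "A \<subseteq> V \<times> V"
    using prey by (auto simp: A_def V_def lines_def upd_pts)
  \<comment> \<open>Arcs strictly increase \<open>place\<close>, which excludes both loops and
    cycles.\<close>
  have up: "A \<subseteq> measure place"
  proof
    fix e assume "e \<in> A"
    then obtain p i c where e: "e = (Inl (p(i := c)), prey (p, i))" "(p, i) \<in> lines n" "c \<in> {1..3}"
      by (auto simp: A_def)
    then have "pos n (p(i := c)) \<le> pos n p"
      by (intro pos_upd_le) (auto simp: lines_def ternary_pts)
    then show "e \<in> measure place" using e prey[OF e(2)] r_ge[OF e(2)] by (simp add: place_def)
  qed
  have "pair_digraph D"
  proof
    show "finite (parcs D)" using finite_subset[OF sub] finV by (simp add: D_def)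
    show "finite (pverts D)" using finV by (simp add: D_def)
  next
    fix e assume "e \<in> parcs D"
    then have e: "e \<in> A" by (simp add: D_def)
    then show "fst e \<in> pverts D" "snd e \<in> pverts D" using sub by (auto simp: D_def)
    have "place (fst e) < place (snd e)" using subsetD[OF up e] by (cases e) simp
    then show "fst e \<noteq> snd e" by auto
  qed
  moreover have "acyclic (parcs D)"
    using acyclic_subset[OF wf_acyclic[OF wf_measure] up] by (simp add: D_def)
  moreover have "competition_graph D = add_isolated (hamming_graph n 3) k"
  proof -
    have "e \<in> parcs (competition_graph D) \<longleftrightarrow> e \<in> parcs (add_isolated (hamming_graph n 3) k)" for e
    proof
      assume "e \<in> parcs (competition_graph D)"
      then obtain a b x where e: "e = (a, b)" "a \<noteq> b" "(a, x) \<in> A" "(b, x) \<in> A"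
        by (auto simp: competition_graph_def D_def)
      obtain p i c where p: "a = Inl (p(i := c))" "x = prey (p, i)" "(p, i) \<in> lines n" "c \<in> {1..3}"
        using e(3) by (auto simp: A_def)
      obtain q j d where q: "b = Inl (q(j := d))" "x = prey (q, j)" "(q, j) \<in> lines n" "d \<in> {1..3}"
        using e(4) by (auto simp: A_def)
      have "(p, i) = (q, j)" using p q by (intro prey_inj) auto
      then have "(p(i := c), q(j := d)) \<in> parcs (hamming_graph n 3)"
        unfolding arcs_hamming_iff using p q e(2)
        by (auto simp: lines_def upd_pts intro!: bexI[of _ i])
      then show "e \<in> parcs (add_isolated (hamming_graph n 3) k)"
        using e(1) p(1) q(1) by (auto simp: add_isolated_def)
    next
      assume "e \<in> parcs (add_isolated (hamming_graph n 3) k)"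
      then obtain u v where e: "e = (Inl u, Inl v)" "(u, v) \<in> parcs (hamming_graph n 3)"
        by (auto simp: add_isolated_def)
      then obtain i where i: "i \<in> {1..n}" "u i \<noteq> v i" "\<forall>j. j \<noteq> i \<longrightarrow> u j = v j"
        and uv: "u \<in> pts n" "v \<in> pts n"
        unfolding arcs_hamming_iff by blast
      \<comment> \<open>The representative of the line through \<open>u\<close> and
        \<open>v\<close>, whose private prey they share.\<close>
      define p where "p = u(i := 3)"
      have l: "(p, i) \<in> lines n" using upd_pts[OF uv(1) i(1), of 3] i(1) by (simp add: lines_def p_def)
      have "u = p(i := u i)" "v = p(i := v i)" using i(3) by (auto simp: p_def)
      moreover have "u i \<in> {1..3}" "v i \<in> {1..3}" using uv i(1) by (auto simp only: PiE_iff)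
      ultimately have "(Inl u, prey (p, i)) \<in> A" "(Inl v, prey (p, i)) \<in> A"
        using l unfolding A_def by blast+
      then show "e \<in> parcs (competition_graph D)"
        using e(1) i(2) sub by (auto simp: competition_graph_def D_def)
    qed
    then have "parcs (competition_graph D) = parcs (add_isolated (hamming_graph n 3) k)" by blast
    then show ?thesis by (simp add: competition_graph_def add_isolated_def D_def V_def)
  qed
  ultimately show ?thesis by blast
qed

theorem theorem1p3:
  fixes n :: nat
  assumes "n \<ge> 3"
  shows "competition_number (hamming_graph n 3) = (n - 3) * 3 ^ (n - 1) + 6"
proof -
  \<comment> \<open>Removes the truncated subtractions, so that the count of lines can be matched by
    ring arithmetic.\<close>
  obtain m where m: "n = m + 3" using assms by (metis add.commute le_Suc_ex)
  have k: "3 ^ n + ((n - 3) * 3 ^ (n - 1) + 6) = card (lines n) + 6"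
    using card_lines[of n] by (simp add: m power_add algebra_simps)
  show ?thesis
    unfolding competition_number_def
  proof (rule Least_equality)
    show "\<exists>D. pair_digraph D \<and> acyclic (parcs D) \<and>
        competition_graph D = add_isolated (hamming_graph n 3) ((n - 3) * 3 ^ (n - 1) + 6)"
      using assms k by (rule competition_upper_bound)
  next
    fix j assume "\<exists>D. pair_digraph D \<and> acyclic (parcs D) \<and>
        competition_graph D = add_isolated (hamming_graph n 3) j"
    then show "(n - 3) * 3 ^ (n - 1) + 6 \<le> j"
      using competition_lower_bound[OF _ _ _ assms] k by fastforce
  qed
qed

end
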